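(* Let $p,q\ge1$ be integers with $p\le q+1$, let $\Re(\beta_q)>\Re(\alpha_p)>0$, let $k_1,\dots,k_p$ be non-negative integers, and suppose none of $\beta_1,\dots,\beta_q$ is zero or a negative integer. Let $c,z\in\mathbb{C}$, $z\ne0$, be inside the region of convergence, that is, such that the series defining the functions on both sides below converge absolutely. Then $$ {}_{p}F_{q}^{(\kappa_l)}\left[\begin{array}{ccc}(\alpha_1,k_1)&\cdots&(\alpha_p,k_p)\\ \beta_1&\cdots&\beta_q\end{array};cz^{k_p};b,d\right]=\frac{\Gamma(\beta_q)z^{1-\beta_q}}{\Gamma(\alpha_p)\Gamma(\beta_q-\alpha_p)}\int_0^zt^{\alpha_p-1}(z-t)^{\beta_q-\alpha_p-1}\;{}_{p-1}F_{q-1}^{(\kappa_l)}\left[\begin{array}{ccc}(\alpha_1,k_1)&\cdots&(\alpha_{p-1},k_{p-1})\\ \beta_1&\cdots&\beta_{q-1}\end{array};ct^{k_p};b,d\right]\Theta\left(-\frac{bz}t-\frac{dz}{z-t}\right)dt , $$ where the integral is along the straight segment from $0$ to $z$.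
   Context: Here $(a)_m=\Gamma(a+m)/\Gamma(a)$ is the Pochhammer symbol and $B(\cdot,\cdot)$ is Euler's beta function. On the segment $t=zv$, $0<v<1$, powers are $t^a=z^av^a$ and $(z-t)^a=z^a(1-v)^a$ with one fixed branch of $\log z$. Let $\{\kappa_l\}_{l\ge0}$ be a complex sequence with $\kappa_0=1$ and let $\Theta(z)=\Theta(\kappa_l;z)$ be a function analytic in a disk $|z|<R$ ($0<R<\infty$) with $\Theta(z)=\sum_{l\ge0}\kappa_l z^l/l!$ there, continued analytically to the half-plane $\Re(z)>0$ with $\Theta(z)=M_0z^{\omega}e^{z}[1+O(1/z)]$ as $\Re(z)\to\infty$ ($M_0>0$, $\omega\in\mathbb{C}$). It is also understood that $\Theta$ is defined and continuous on $\Re(z)\le 0$ and that the following integrals converge absolutely. For $\Re(b),\Re(d)\ge0$ and $\Re(\alpha),\Re(\beta)>0$, $$\mathcal{B}^{(\kappa_l)}_{b,d}(\alpha,\beta)=\int_0^1t^{\alpha-1}(1-t)^{\beta-1}\Theta\left(-\frac bt-\frac d{1-t}\right)dt .$$ For non-negative integers $k_1,\dots,k_p$ the function ${}_pF_q^{(\kappa_l)}\left[\begin{array}{ccc}(\alpha_1,k_1)&\cdots&(\alpha_p,k_p)\\ \beta_1&\cdots&\beta_q\end{array};z;b,d\right]$ is defined by: (i) if $p=q+1$, $|z|<1$: $\displaystyle\sum_{m\ge0}(\alpha_1)_{k_1m}\prod_{j=1}^q\frac{\mathcal{B}^{(\kappa_l)}_{b,d}(\alpha_{j+1}+k_{j+1}m,\beta_j-\alpha_{j+1})}{B(\alpha_{j+1},\beta_j-\alpha_{j+1})}\frac{z^m}{m!}$;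 (ii) if $p=q$: $\displaystyle\sum_{m\ge0}\prod_{j=1}^q\frac{\mathcal{B}^{(\kappa_l)}_{b,d}(\alpha_j+k_jm,\beta_j-\alpha_j)}{B(\alpha_j,\beta_j-\alpha_j)}\frac{z^m}{m!}$; (iii) if $p<q$, $r=q-p$: $\displaystyle\sum_{m\ge0}\frac1{(\beta_1)_m\cdots(\beta_r)_m}\prod_{j=1}^p\frac{\mathcal{B}^{(\kappa_l)}_{b,d}(\alpha_j+k_jm,\beta_{r+j}-\alpha_j)}{B(\alpha_j,\beta_{r+j}-\alpha_j)}\frac{z^m}{m!}$. The parameters are such that all (extended) beta functions occurring have arguments with positive real part; empty products equal $1$. *)

theory Defs
  imports "HOL-Complex_Analysis.Complex_Analysis" "HOL-Library.Landau_Symbols"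
begin

text \<open>
  The kernel \<open>\<Theta>\<close> attached to a sequence \<open>\<kappa>\<close>. The limit \<open>Re z \<rightarrow> \<infinity>\<close> is the filter
  \<open>filtercomap Re at_top\<close>, so the error term is uniform in \<open>Im z\<close>; \<open>z powr \<omega>\<close> is the
  principal power, which is the natural one on the right half-plane. On the closed left
  half-plane \<open>\<Theta>\<close> is only required to be continuous, so it is not determined by \<open>\<kappa>\<close>, and
  the functions below take \<open>\<Theta>\<close> rather than \<open>\<kappa>\<close> as parameter.
\<close>

definition theta_kernel ::
  "(nat \<Rightarrow> complex) \<Rightarrow> real \<Rightarrow> real \<Rightarrow> complex \<Rightarrow> (complex \<Rightarrow> complex) \<Rightarrow> bool" where
  "theta_kernel \<kappa> R M0 \<omega> \<Theta> \<longleftrightarrow>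
     \<kappa> 0 = 1 \<and> 0 < R \<and> 0 < M0 \<and>
     \<Theta> analytic_on (ball 0 R \<union> {z. 0 < Re z}) \<and>
     (\<forall>z\<in>ball 0 R. (\<lambda>l. \<kappa> l * z ^ l / fact l) sums \<Theta> z) \<and>
     (\<lambda>z. \<Theta> z / (of_real M0 * z powr \<omega> * exp z) - 1) \<in> O[filtercomap Re at_top](\<lambda>z. 1 / z) \<and>
     continuous_on {z. Re z \<le> 0} \<Theta>"

definition ext_beta_integrand ::
  "(complex \<Rightarrow> complex) \<Rightarrow> complex \<Rightarrow> complex \<Rightarrow> complex \<Rightarrow> complex \<Rightarrow> real \<Rightarrow> complex" where
  "ext_beta_integrand \<Theta> b d x y t =
     of_real t powr (x - 1) * of_real (1 - t) powr (y - 1) *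
     \<Theta> (- b / of_real t - d / of_real (1 - t))"

definition ext_beta ::
  "(complex \<Rightarrow> complex) \<Rightarrow> complex \<Rightarrow> complex \<Rightarrow> complex \<Rightarrow> complex \<Rightarrow> complex" where
  "ext_beta \<Theta> b d x y =
     set_lebesgue_integral lborel {0<..<1} (ext_beta_integrand \<Theta> b d x y)"

text \<open>
  The parameters \<open>\<alpha>\<close>, \<open>k\<close> are used at the indices \<open>1..p\<close> and \<open>\<beta>\<close> at \<open>1..q\<close>, so
  the function with the last entry of each row removed is obtained by passing
  \<open>p - 1\<close>, \<open>q - 1\<close> with the same \<open>\<alpha>\<close>, \<open>k\<close>, \<open>\<beta>\<close>.
  Only \<open>p \<le> q + 1\<close> is meaningful.
\<close>

definition ext_hyp_term ::
  "nat \<Rightarrow> nat \<Rightarrow> (complex \<Rightarrow> complex) \<Rightarrow> (nat \<Rightarrow> complex) \<Rightarrow> (nat \<Rightarrow> nat) \<Rightarrow> (nat \<Rightarrow> complex) \<Rightarrow>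
   complex \<Rightarrow> complex \<Rightarrow> complex \<Rightarrow> nat \<Rightarrow> complex" where
  "ext_hyp_term p q \<Theta> \<alpha> k \<beta> z b d m =
    (if p = q + 1 then
       pochhammer (\<alpha> 1) (k 1 * m) *
       (\<Prod>j = 1..q. ext_beta \<Theta> b d (\<alpha> (j + 1) + of_nat (k (j + 1) * m)) (\<beta> j - \<alpha> (j + 1)) /
                    Beta (\<alpha> (j + 1)) (\<beta> j - \<alpha> (j + 1))) *
       (z ^ m / fact m)
     else if p = q then
       (\<Prod>j = 1..q. ext_beta \<Theta> b d (\<alpha> j + of_nat (k j * m)) (\<beta> j - \<alpha> j) /
                    Beta (\<alpha> j) (\<beta> j - \<alpha> j)) *
       (z ^ m / fact m)
     else if p < q then
       1 / (\<Prod>j = 1..q - p. pochhammer (\<beta> j) m) *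
       (\<Prod>j = 1..p. ext_beta \<Theta> b d (\<alpha> j + of_nat (k j * m)) (\<beta> (q - p + j) - \<alpha> j) /
                    Beta (\<alpha> j) (\<beta> (q - p + j) - \<alpha> j)) *
       (z ^ m / fact m)
     else undefined)"

definition ext_hyp ::
  "nat \<Rightarrow> nat \<Rightarrow> (complex \<Rightarrow> complex) \<Rightarrow> (nat \<Rightarrow> complex) \<Rightarrow> (nat \<Rightarrow> nat) \<Rightarrow> (nat \<Rightarrow> complex) \<Rightarrow>
   complex \<Rightarrow> complex \<Rightarrow> complex \<Rightarrow> complex" where
  "ext_hyp p q \<Theta> \<alpha> k \<beta> z b d = (\<Sum>m. ext_hyp_term p q \<Theta> \<alpha> k \<beta> z b d m)"

text \<open>
  The bound \<open>norm z < 1\<close> is part of the definition of the function when \<open>p = q + 1\<close>.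
\<close>

definition ext_hyp_converges ::
  "nat \<Rightarrow> nat \<Rightarrow> (complex \<Rightarrow> complex) \<Rightarrow> (nat \<Rightarrow> complex) \<Rightarrow> (nat \<Rightarrow> nat) \<Rightarrow> (nat \<Rightarrow> complex) \<Rightarrow>
   complex \<Rightarrow> complex \<Rightarrow> complex \<Rightarrow> bool" where
  "ext_hyp_converges p q \<Theta> \<alpha> k \<beta> z b d \<longleftrightarrow>
     (p = q + 1 \<longrightarrow> norm z < 1) \<and>
     summable (\<lambda>m. norm (ext_hyp_term p q \<Theta> \<alpha> k \<beta> z b d m))"

text \<open>
  The arguments of all beta functions occurring in \<^const>\<open>ext_hyp_term\<close> have positive real
  part; since \<open>k j * m \<ge> 0\<close>, it is enough to ask this of the arguments with \<open>m = 0\<close>.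
\<close>

definition beta_args_pos :: "nat \<Rightarrow> nat \<Rightarrow> (nat \<Rightarrow> complex) \<Rightarrow> (nat \<Rightarrow> complex) \<Rightarrow> bool" where
  "beta_args_pos p q \<alpha> \<beta> \<longleftrightarrow>
    (if p = q + 1 then \<forall>j\<in>{1..q}. 0 < Re (\<alpha> (j + 1)) \<and> 0 < Re (\<beta> j - \<alpha> (j + 1))
     else \<forall>j\<in>{1..p}. 0 < Re (\<alpha> j) \<and> 0 < Re (\<beta> (q - p + j) - \<alpha> j))"

text \<open>
  Complex powers with one fixed branch: \<open>L\<close> is the chosen value of \<open>log z\<close>, where
  \<open>z = exp L\<close>. For \<open>w = z v\<close> with \<open>0 < v \<le> 1\<close> the quotient \<open>w / exp L\<close> is \<open>v\<close> and
  the value is \<open>z\<^sup>a v\<^sup>a\<close> with \<open>z\<^sup>a = exp (a L)\<close> and the real logarithm of \<open>v\<close>.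
\<close>

definition ray_powr :: "complex \<Rightarrow> complex \<Rightarrow> complex \<Rightarrow> complex" where
  "ray_powr L w a = exp (a * (L + Ln (w / exp L)))"

end

theory Submission
  imports Defs
begin

text \<open>
  Substituting \<open>t = z v\<close> and integrating the inner series term by term gives the formula, because
  the \<open>m\<close>-th term on the left is the \<open>m\<close>-th term of the inner series at \<open>c z\<^sup>k\<close> times a shifted
  extended beta function. Fubini needs the inner series to converge absolutely at the end point
  \<open>c z\<^sup>k\<close>. The extended beta factors are bounded in \<open>m\<close>, so this is clear unless \<open>p = q + 1\<close> and
  \<open>k\<^sub>1 \<ge> 2\<close>, when the Pochhammer factor grows superexponentially relative to \<open>m!\<close> or
  the series terminates. In the former case convergence at one nonzero point makes the product
  \<open>H m\<close> of the extended beta factors decay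
  superexponentially. But \<open>H m\<close> is the \<open>m\<close>-th moment of a complex measure on \<open>[0, 1]\<close>, so
  \<open>G w = \<Sum>H m w\<^sup>m\<close> is an entire function equal to the integral of \<open>1 / (1 - w u)\<close> off the real
  axis, whence \<open>\<bar>G w\<bar> \<le> M \<bar>w\<bar> / \<bar>Im w\<bar>\<close>. On the circle \<open>\<bar>w\<bar> = r\<close> one has
  \<open>\<bar>w\<^sup>2 - r\<^sup>2\<bar> = 2 r \<bar>Im w\<bar>\<close>, so Cauchy's inequalities for \<open>(w\<^sup>2 - r\<^sup>2) G w\<close> with
  \<open>r \<rightarrow> \<infinity>\<close> give \<open>H m = 0\<close> for \<open>m \<ge> 2\<close>, and the series is a finite sum.
\<close>

section \<open>Moment sequences on the unit interval with entire generating function\<close>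

text \<open>Multiplying by \<open>cnj w\<close> turns \<open>w * u\<close> into a real number, so
  the imaginary part of the product does not depend on \<open>u\<close>. This bounds the kernel
  \<open>1 / (1 - w * u)\<close> uniformly in real \<open>u\<close>, off the real axis.\<close>

lemma norm_one_minus_mult_of_real_ge:
  fixes w :: complex and u :: real
  shows "\<bar>Im w\<bar> \<le> norm w * norm (1 - w * of_real u)"
proof -
  have "cnj w * (1 - w * of_real u) = cnj w - of_real (u * (norm w)\<^sup>2)"
    using complex_norm_square[of w] by (simp add: algebra_simps)
  hence "Im (cnj w * (1 - w * of_real u)) = - Im w"
    by simp
  thus ?thesis
    using abs_Im_le_cmod[of "cnj w * (1 - w * of_real u)"] by (simp add: norm_mult)
qed

text \<open>Allowing any measure \<open>N\<close> with a function \<open>u\<close> into the unit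
  interval lets product measures enter without forming an image measure. A mass at
  \<open>u = 0\<close> contributes to the zeroth moment only, so some shift of the index is
  unavoidable; the shift by 2 is the degree of \<open>w\<^sup>2 - r\<^sup>2\<close>.\<close>

lemma moment_vanishes_if_generating_function_entire:
  fixes N :: "'a measure" and h :: "'a \<Rightarrow> complex" and u :: "'a \<Rightarrow> real"
  assumes h: "integrable N h" and u [measurable]: "u \<in> borel_measurable N"
    and u01: "\<And>x. 0 \<le> u x" "\<And>x. u x \<le> 1"
    and entire: "\<And>w. summable (\<lambda>m. (\<integral>x. of_real (u x) ^ m * h x \<partial>N) * w ^ m)"
  shows "(\<integral>x. of_real (u x) ^ (m + 2) * h x \<partial>N) = 0"
proof -
  note [measurable] = borel_measurable_integrable[OF h]
  define a where "a m = (\<integral>x. of_real (u x) ^ m * h x \<partial>N)" for m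
  define M where "M = (\<integral>x. norm (h x) \<partial>N)"
  define G where "G w = (\<Sum>m. a m * w ^ m)" for w
  define T where "T w = (\<integral>x. h x / (1 - w * of_real (u x)) \<partial>N)" for w
  have sm: "summable (\<lambda>m. a m * w ^ m)" for w
    using entire unfolding a_def .
  have dG: "(G has_field_derivative (\<Sum>n. diffs a n * x ^ n)) (at x)" for x
    unfolding G_def by (rule termdiffs_strong_converges_everywhere) (rule sm)
  have holG: "G holomorphic_on A" for A
    using dG by (meson holomorphic_on_open holomorphic_on_subset open_UNIV subset_UNIV)
  have M0: "M \<ge> 0" unfolding M_def by simp
  have integ: "integrable N (\<lambda>x. g x * h x)"
    if [measurable]: "g \<in> borel_measurable N" and "\<And>x. norm (g x) \<le> C" for g :: "'a \<Rightarrow> complex" and C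
  proof (rule Bochner_Integration.integrable_bound[of _ "\<lambda>x. C * norm (h x)"])
    show "AE x in N. norm (g x * h x) \<le> norm (C * norm (h x))"
    proof (rule AE_I2)
      fix x
      have "norm (g x * h x) \<le> C * norm (h x)"
        unfolding norm_mult by (intro mult_right_mono that) auto
      thus "norm (g x * h x) \<le> norm (C * norm (h x))" by simp
    qed
  qed (use h in auto)
  have inv_bound: "norm (1 / (1 - w * of_real y)) \<le> norm w / \<bar>Im w\<bar>"
    if "Im w \<noteq> 0" for w and y :: real
  proof -
    have "norm (1 - w * of_real y) > 0"
      using norm_one_minus_mult_of_real_ge[of w y] that by (smt (verit) mult_eq_0_iff norm_ge_zero)
    thus ?thesis
      using norm_one_minus_mult_of_real_ge[of w y] that by (simp add: norm_divide field_simps)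
  qed
  have nz: "1 - w * of_real y \<noteq> 0" if "Im w \<noteq> 0" for w and y :: real
    using norm_one_minus_mult_of_real_ge[of w y] that by auto
  have intT: "integrable N (\<lambda>x. h x / (1 - w * of_real (u x)))" if "Im w \<noteq> 0" for w
    using integ[of "\<lambda>x. 1 / (1 - w * of_real (u x))" "norm w / \<bar>Im w\<bar>"] inv_bound[OF that]
    by simp
  have T_bound: "norm (T w) * \<bar>Im w\<bar> \<le> norm w * M" if "Im w \<noteq> 0" for w
  proof -
    have "norm (T w) \<le> (\<integral>x. norm (h x / (1 - w * of_real (u x))) \<partial>N)"
      unfolding T_def by (rule integral_norm_bound)
    also have "\<dots> \<le> (\<integral>x. norm w / \<bar>Im w\<bar> * norm (h x) \<partial>N)"
    proof (rule integral_mono)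
      fix x
      show "norm (h x / (1 - w * of_real (u x))) \<le> norm w / \<bar>Im w\<bar> * norm (h x)"
        using mult_right_mono[OF inv_bound[OF that, of "u x"], of "norm (h x)"]
        by (simp add: norm_divide)
    qed (use intT[OF that] h in auto)
    also have "\<dots> = norm w / \<bar>Im w\<bar> * M"
      unfolding M_def by simp
    finally show ?thesis using that by (simp add: field_simps)
  qed
  have T_deriv: "(T has_field_derivative
      (\<integral>x. of_real (u x) / (1 - w0 * of_real (u x))\<^sup>2 * h x \<partial>N)) (at w0)"
    if w0: "Im w0 \<noteq> 0" for w0
  proof -
    \<comment> \<open>On this neighbourhood of \<open>w0\<close> the modulus is bounded and the
      distance to the real axis stays positive, so the single constant \<open>C\<close> bounds all
      kernels. Dominated convergence with majorant \<open>C * C * norm (h x)\<close> then allows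
      differentiation under the integral.\<close>
    define S where "S = {w. \<bar>Im w\<bar> > \<bar>Im w0\<bar> / 2} \<inter> ball 0 (norm w0 + 1)"
    define C where "C = (norm w0 + 1) / (\<bar>Im w0\<bar> / 2)"
    have S: "open S" "w0 \<in> S"
      unfolding S_def using w0 by (auto intro!: open_Int open_Collect_less continuous_intros)
    have S_bd: "norm (1 / (1 - w * of_real y)) \<le> C" "Im w \<noteq> 0" if "w \<in> S" for w and y :: real
    proof -
      have im: "\<bar>Im w\<bar> > \<bar>Im w0\<bar> / 2" "norm w \<le> norm w0 + 1" using that unfolding S_def by auto
      thus "Im w \<noteq> 0" by auto
      hence "norm (1 / (1 - w * of_real y)) \<le> norm w / \<bar>Im w\<bar>" by (rule inv_bound)
      also have "\<dots> \<le> C" unfolding C_def using im w0 by (intro frac_le) auto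
      finally show "norm (1 / (1 - w * of_real y)) \<le> C" .
    qed
    have "((\<lambda>w. (T w - T w0) / (w - w0)) \<longlongrightarrow>
        (\<integral>x. of_real (u x) / (1 - w0 * of_real (u x))\<^sup>2 * h x \<partial>N)) (at w0 within S)"
      unfolding tendsto_at_iff_sequentially
    proof (intro allI impI)
      fix X assume X: "\<forall>i. X i \<in> S - {w0}" and lim: "X \<longlonglongrightarrow> w0"
      have eq: "(T (X i) - T w0) / (X i - w0) =
          (\<integral>x. of_real (u x) * (1 / (1 - X i * of_real (u x))) * (1 / (1 - w0 * of_real (u x))) * h x \<partial>N)" for i
      proof -
        have i: "Im (X i) \<noteq> 0" "X i \<noteq> w0" using S_bd(2) X by auto
        have "(T (X i) - T w0) / (X i - w0) =
           (\<integral>x. (h x / (1 - X i * of_real (u x)) - h x / (1 - w0 * of_real (u x))) / (X i - w0) \<partial>N)"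
          unfolding T_def using intT[OF i(1)] intT[OF w0] by simp
        also have "\<dots> = (\<integral>x. of_real (u x) * (1 / (1 - X i * of_real (u x))) * (1 / (1 - w0 * of_real (u x))) * h x \<partial>N)"
        proof (rule Bochner_Integration.integral_cong[OF refl])
          fix x
          show "(h x / (1 - X i * of_real (u x)) - h x / (1 - w0 * of_real (u x))) / (X i - w0) =
             of_real (u x) * (1 / (1 - X i * of_real (u x))) * (1 / (1 - w0 * of_real (u x))) * h x"
            using nz[OF i(1), of "u x"] nz[OF w0, of "u x"] i(2)
            by (simp add: divide_simps) (simp add: algebra_simps)
        qed
        finally show ?thesis .
      qed
      have "(\<lambda>i. (\<integral>x. of_real (u x) * (1 / (1 - X i * of_real (u x))) * (1 / (1 - w0 * of_real (u x))) * h x \<partial>N))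
          \<longlonglongrightarrow> (\<integral>x. of_real (u x) / (1 - w0 * of_real (u x))\<^sup>2 * h x \<partial>N)"
      proof (rule integral_dominated_convergence[where w = "\<lambda>x. (1 * C * C) * norm (h x)"])
        show "AE x in N. (\<lambda>i. of_real (u x) * (1 / (1 - X i * of_real (u x))) * (1 / (1 - w0 * of_real (u x))) * h x)
            \<longlonglongrightarrow> of_real (u x) / (1 - w0 * of_real (u x))\<^sup>2 * h x"
        proof (rule AE_I2)
          fix x
          have "(\<lambda>i. of_real (u x) * (1 / (1 - X i * of_real (u x))) * (1 / (1 - w0 * of_real (u x))) * h x)
            \<longlonglongrightarrow> of_real (u x) * (1 / (1 - w0 * of_real (u x))) * (1 / (1 - w0 * of_real (u x))) * h x"
            by (intro tendsto_intros lim nz w0)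
          thus "(\<lambda>i. of_real (u x) * (1 / (1 - X i * of_real (u x))) * (1 / (1 - w0 * of_real (u x))) * h x)
            \<longlonglongrightarrow> of_real (u x) / (1 - w0 * of_real (u x))\<^sup>2 * h x"
            by (simp add: power2_eq_square)
        qed
        show "AE x in N. norm (of_real (u x) * (1 / (1 - X i * of_real (u x))) * (1 / (1 - w0 * of_real (u x))) * h x)
          \<le> (1 * C * C) * norm (h x)" for i
        proof (rule AE_I2)
          fix x
          have C0: "0 \<le> C" unfolding C_def by simp
          show "norm (of_real (u x) * (1 / (1 - X i * of_real (u x))) * (1 / (1 - w0 * of_real (u x))) * h x)
             \<le> (1 * C * C) * norm (h x)"
            unfolding norm_mult using u01[of x] X S S_bd C0
            by (intro mult_right_mono mult_mono) auto
        qed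
      qed (use h in auto)
      thus "((\<lambda>w. (T w - T w0) / (w - w0)) \<circ> X) \<longlonglongrightarrow>
          (\<integral>x. of_real (u x) / (1 - w0 * of_real (u x))\<^sup>2 * h x \<partial>N)"
        unfolding o_def eq .
    qed
    thus ?thesis
      unfolding has_field_derivative_iff at_within_open[OF S(2,1)] .
  qed
  have small: "G w = T w" if "norm w < 1" for w
  proof -
    have lt: "norm (w * of_real (u x)) < 1" for x
      using that u01[of x] mult_left_mono[of "u x" 1 "norm w"] by (simp add: norm_mult)
    have pw: "norm (of_real (u x) ^ m :: complex) \<le> 1" for x m
      using u01[of x] by (simp add: norm_power power_le_one)
    have I: "integrable N (\<lambda>x. w ^ m * (of_real (u x) ^ m * h x))" for m
      by (intro integrable_mult_right integ[of _ 1] pw) measurable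
    have le: "norm (w ^ m * (of_real (u x) ^ m * h x)) \<le> norm w ^ m * norm (h x)" for m x
      using pw[of x m] by (simp add: norm_mult norm_power mult_left_mono mult_left_le_one_le)
    have "(\<lambda>m. \<integral>x. w ^ m * (of_real (u x) ^ m * h x) \<partial>N) sums
        (\<integral>x. (\<Sum>m. w ^ m * (of_real (u x) ^ m * h x)) \<partial>N)"
    proof (rule sums_integral[OF I])
      show "AE x in N. summable (\<lambda>m. norm (w ^ m * (of_real (u x) ^ m * h x)))"
      proof (rule AE_I2)
        fix x
        show "summable (\<lambda>m. norm (w ^ m * (of_real (u x) ^ m * h x)))"
          by (rule summable_comparison_test'[of "\<lambda>m. norm w ^ m * norm (h x)"])
             (use le that in \<open>auto intro!: summable_mult2 summable_geometric\<close>)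
      qed
      show "summable (\<lambda>m. \<integral>x. norm (w ^ m * (of_real (u x) ^ m * h x)) \<partial>N)"
      proof (rule summable_comparison_test'[of "\<lambda>m. norm w ^ m * M"])
        show "summable (\<lambda>m. norm w ^ m * M)"
          using that by (auto intro!: summable_mult2 summable_geometric)
        fix m :: nat
        have "(\<integral>x. norm (w ^ m * (of_real (u x) ^ m * h x)) \<partial>N) \<le> (\<integral>x. norm w ^ m * norm (h x) \<partial>N)"
          by (rule integral_mono) (use I h le in auto)
        thus "norm (\<integral>x. norm (w ^ m * (of_real (u x) ^ m * h x)) \<partial>N) \<le> norm w ^ m * M"
          by (simp add: M_def)
      qed
    qed
    moreover have "(\<Sum>m. w ^ m * (of_real (u x) ^ m * h x)) = h x / (1 - w * of_real (u x))" for x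
    proof -
      have "(\<lambda>m. (w * of_real (u x)) ^ m * h x) sums (1 / (1 - w * of_real (u x)) * h x)"
        by (intro sums_mult2 geometric_sums lt)
      thus ?thesis by (simp add: sums_iff power_mult_distrib mult.assoc)
    qed
    ultimately have "(\<lambda>m. a m * w ^ m) sums T w"
      by (simp add: T_def a_def mult.commute)
    thus ?thesis unfolding G_def by (simp add: sums_iff)
  qed
  have GT: "G w = T w" if w: "Im w \<noteq> 0" for w
  proof -
    \<comment> \<open>\<open>P\<close> is the open half-plane, above or below the real axis, that
      contains \<open>w\<close>. It is connected and meets the unit disc, where the geometric series
      has given \<open>G = T\<close>, so the identity theorem applies.\<close>
    define s where "s = sgn (Im w)"
    define P where "P = {x. 0 < s * Im x}"
    have wP: "w \<in> P" using w by (simp add: P_def s_def sgn_if)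
    have s0: "s \<noteq> 0" using w by (simp add: s_def sgn_eq_0_iff)
    have P: "open P" unfolding P_def by (intro open_Collect_less continuous_intros)
    have "convex P"
    proof -
      have "P = {x. inner (of_real s * \<i>) x > 0}"
        by (simp add: P_def inner_complex_def)
      thus ?thesis by (simp add: convex_halfspace_gt)
    qed
    have hT: "T holomorphic_on P"
    proof (unfold holomorphic_on_open[OF P], intro ballI)
      fix x assume "x \<in> P"
      hence "Im x \<noteq> 0" by (auto simp: P_def)
      from T_deriv[OF this] show "\<exists>f'. (T has_field_derivative f') (at x)" by blast
    qed
    show ?thesis
    proof (rule analytic_continuation_open[where f = G and g = T, of "P \<inter> ball 0 1" P])
      show "P \<inter> ball 0 1 \<noteq> {}"
      proof -
        have "of_real (s / 2) * \<i> \<in> P \<inter> ball 0 1"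
          using s0 by (auto simp: P_def norm_mult s_def abs_sgn sgn_if)
        thus ?thesis by blast
      qed
    qed (use P \<open>convex P\<close> hT holG wP small in \<open>auto intro: convex_connected\<close>)
  qed
  \<comment> \<open>On the real axis, where \<open>T\<close> gives no information, the left side is
    0.\<close>
  have G_bound: "norm (G w) * \<bar>Im w\<bar> \<le> norm w * M" for w
    using T_bound[of w] GT[of w] M0 by (cases "Im w = 0") auto
  have fpsG: "G has_fps_expansion Abs_fps a"
  proof -
    have "fps_conv_radius (Abs_fps a) = \<infinity>"
      unfolding fps_conv_radius_def by (rule conv_radius_inftyI'') (simp add: sm)
    thus ?thesis
      unfolding has_fps_expansion_def by (auto simp: eval_fps_def G_def)
  qed
  \<comment> \<open>The coefficient of index \<open>m + 2\<close> of
    \<open>(w\<^sup>2 - r\<^sup>2) * G w\<close> is \<open>a m - r\<^sup>2 * a (m + 2)\<close>.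
    Cauchy's inequality keeps it bounded as \<open>r\<close> grows, which forces
    \<open>a (m + 2)\<close> to be 0.\<close>
  have key: "norm (a (m + 2)) \<le> (norm (a m) + 2 * M) / r\<^sup>2" if r: "r \<ge> 1" for r :: real
  proof -
    let ?F = "\<lambda>w. (w ^ 2 - of_real (r\<^sup>2)) * G w"
    have "?F has_fps_expansion (fps_X ^ 2 - fps_const (of_real (r\<^sup>2))) * Abs_fps a"
      by (intro has_fps_expansion_mult has_fps_expansion_diff has_fps_expansion_power
          has_fps_expansion_fps_X has_fps_expansion_const fpsG)
    from fps_nth_fps_expansion[OF this, of "m + 2"]
    have "(deriv ^^ (m + 2)) ?F 0 / fact (m + 2) = a m - of_real (r\<^sup>2) * a (m + 2)"
      by (subst (asm) eq_commute) (simp add: left_diff_distrib fps_X_power_mult_nth del: funpow.simps)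
    hence coeff: "(deriv ^^ (m + 2)) ?F 0 = fact (m + 2) * (a m - of_real (r\<^sup>2) * a (m + 2))"
      unfolding nonzero_divide_eq_eq[OF fact_nonzero] by (simp only: mult.commute)
    have "norm ((deriv ^^ (m + 2)) ?F 0) \<le> fact (m + 2) * (2 * r\<^sup>2 * M) / r ^ (m + 2)"
    proof (rule Cauchy_inequality)
      have hol: "?F holomorphic_on A" for A by (intro holomorphic_intros holG)
      show "?F holomorphic_on ball 0 r" by (rule hol)
      show "continuous_on (cball 0 r) ?F" by (rule holomorphic_on_imp_continuous_on[OF hol])
      show "0 < r" using r by simp
      \<comment> \<open>On the circle \<open>r\<^sup>2 = w * cnj w\<close>, so the zeros of the
        polynomial at \<open>r\<close> and \<open>- r\<close> cancel the blow-up of the bound on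
        \<open>G\<close> near the real axis.\<close>
      fix w :: complex assume "norm (0 - w) = r"
      hence w: "norm w = r" by simp
      have "w\<^sup>2 - of_real (r\<^sup>2) = w * (w - cnj w)"
        using complex_norm_square[of w] w by (simp add: power2_eq_square algebra_simps)
      hence "norm (w\<^sup>2 - of_real (r\<^sup>2)) = 2 * r * \<bar>Im w\<bar>"
        using w by (simp add: norm_mult complex_diff_cnj)
      hence "norm (?F w) = 2 * r * (norm (G w) * \<bar>Im w\<bar>)"
        by (simp add: norm_mult)
      also have "\<dots> \<le> 2 * r * (norm w * M)"
        using r by (intro mult_left_mono G_bound) auto
      finally show "norm (?F w) \<le> 2 * r\<^sup>2 * M"
        using w by (simp add: power2_eq_square)
    qed
    hence "fact (m + 2) * norm (a m - of_real (r\<^sup>2) * a (m + 2)) \<le> fact (m + 2) * (2 * r\<^sup>2 * M / r ^ (m + 2))"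
      unfolding coeff norm_mult norm_fact by (simp only: times_divide_eq_right)
    hence "norm (a m - of_real (r\<^sup>2) * a (m + 2)) \<le> 2 * r\<^sup>2 * M / r ^ (m + 2)"
      by (simp only: mult_le_cancel_left_pos[OF fact_gt_zero])
    \<comment> \<open>The quotient equals \<open>2 * M / r ^ m\<close>, and
      \<open>r \<ge> 1\<close>.\<close>
    also have "\<dots> \<le> 2 * M"
      using r M0 mult_left_mono[OF one_le_power[OF r, of m], of M]
      by (simp add: field_simps power_add power2_eq_square)
    finally have "norm (of_real (r\<^sup>2) * a (m + 2)) \<le> norm (a m) + 2 * M"
      using norm_triangle_ineq2[of "of_real (r\<^sup>2) * a (m + 2)" "a m"]
      by (simp add: norm_minus_commute)
    hence "r\<^sup>2 * norm (a (m + 2)) \<le> norm (a m) + 2 * M"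
      by (simp add: norm_mult norm_power)
    thus ?thesis using r by (simp add: field_simps)
  qed
  have "((\<lambda>r::real. (norm (a m) + 2 * M) / r\<^sup>2) \<longlongrightarrow> 0) at_top"
    by (intro tendsto_divide_0[OF tendsto_const] filterlim_at_top_imp_at_infinity
        filterlim_pow_at_top filterlim_ident) auto
  moreover have "eventually (\<lambda>r. norm (a (m + 2)) \<le> (norm (a m) + 2 * M) / r\<^sup>2) at_top"
    using eventually_ge_at_top[of "1::real"] by eventually_elim (rule key)
  ultimately have "norm (a (m + 2)) \<le> 0"
    using tendsto_lowerbound trivial_limit_at_top_linorder by blast
  thus ?thesis by (simp add: a_def)
qed

section \<open>Lower bound for Pochhammer symbols\<close>

text \<open>The quotient of the two products has factors \<open>(a + i) / (i + 1)\<close>, which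
  never vanish and tend to 1. Their moduli thus exceed 1/2 from some index on, and
  \<open>\<delta>\<close> is the minimum of 1/2 and the finitely many earlier ones.\<close>

lemma fact_le_norm_pochhammer:
  fixes a :: complex
  assumes "a \<notin> \<int>\<^sub>\<le>\<^sub>0"
  obtains \<delta> where "\<delta> > 0" "\<And>n. \<delta> ^ n * fact n \<le> norm (pochhammer a n)"
proof -
  have nz: "a + of_nat i \<noteq> 0" for i
    using assms by (metis add_eq_0_iff2 minus_of_nat_in_nonpos_Ints)
  have "(\<lambda>i. norm ((a + of_nat i) / of_nat (Suc i))) \<longlonglongrightarrow> norm (1 :: complex)"
  proof (rule tendsto_norm)
    have "(\<lambda>i. (a - 1) * inverse (of_nat (Suc i)) + 1) \<longlonglongrightarrow> (a - 1) * 0 + 1"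
      by (intro tendsto_intros LIMSEQ_Suc[OF lim_inverse_n])
    moreover have "(a - 1) * inverse (of_nat (Suc i)) + 1 = (a + of_nat i) / of_nat (Suc i)" for i
      by (simp add: field_simps del: of_nat_Suc) (simp add: algebra_simps)
    ultimately show "(\<lambda>i. (a + of_nat i) / of_nat (Suc i)) \<longlonglongrightarrow> 1" by simp
  qed
  from order_tendstoD(1)[OF this, of "1 / 2"]
  obtain N where N: "\<And>i. i \<ge> N \<Longrightarrow> norm ((a + of_nat i) / of_nat (Suc i)) > 1 / 2"
    by (auto simp: eventually_sequentially)
  define \<delta> where "\<delta> = Min (insert (1 / 2) ((\<lambda>i. norm ((a + of_nat i) / of_nat (Suc i))) ` {..<N}))"
  have \<delta>: "\<delta> > 0"
    unfolding \<delta>_def using nz by (subst Min_gr_iff) (auto simp del: of_nat_Suc)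
  have le: "\<delta> \<le> norm ((a + of_nat i) / of_nat (Suc i))" for i
  proof (cases "i < N")
    case True
    thus ?thesis unfolding \<delta>_def by (intro Min_le) auto
  next
    case False
    have "\<delta> \<le> 1 / 2" unfolding \<delta>_def by (intro Min_le) auto
    with N[of i] False show ?thesis by auto
  qed
  have "\<delta> ^ n * fact n \<le> norm (pochhammer a n)" for n
  proof (induction n)
    case (Suc n)
    have "\<delta> * real (Suc n) \<le> norm (a + of_nat n)"
      using le[of n] by (simp add: norm_divide field_simps del: of_nat_Suc)
    hence "(\<delta> ^ n * fact n) * (\<delta> * real (Suc n)) \<le> norm (pochhammer a n) * norm (a + of_nat n)"
      using Suc.IH \<delta> by (intro mult_mono) auto
    thus ?case unfolding pochhammer_Suc norm_mult by (simp add: algebra_simps)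
  qed auto
  with \<delta> that show thesis by blast
qed

section \<open>Extended beta functions as moments\<close>

lemma ext_beta_integrand_add_of_nat:
  assumes "0 < t"
  shows "ext_beta_integrand \<Theta> b d (x + of_nat n) y t = of_real t ^ n * ext_beta_integrand \<Theta> b d x y t"
proof -
  have "of_real t powr (x + of_nat n - 1) = of_real t powr (x - 1) * (of_real t :: complex) ^ n"
    using assms powr_add[of "of_real t" "x - 1" "of_nat n"] by (simp add: powr_nat' algebra_simps)
  thus ?thesis unfolding ext_beta_integrand_def by simp
qed

text \<open>Clamping \<open>t\<close> to the unit interval changes nothing where the indicator is 1,
  and makes the power at most 1 on the whole line, so later bounds need no case distinction.\<close>

lemma ext_beta_add_of_nat:
  "ext_beta \<Theta> b d (x + of_nat n) y =
     (\<integral>t. of_real (max 0 (min 1 t)) ^ n * (indicator {0<..<1} t *\<^sub>R ext_beta_integrand \<Theta> b d x y t) \<partial>lborel)"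
  unfolding ext_beta_def set_lebesgue_integral_def
  by (intro Bochner_Integration.integral_cong)
     (auto simp: ext_beta_integrand_add_of_nat indicator_def)

lemma norm_unit_power_mult_le:
  fixes z :: complex
  shows "norm (of_real (max 0 (min 1 t)) ^ n * z) \<le> norm z"
proof -
  have "\<bar>max 0 (min 1 t)\<bar> ^ n \<le> 1" by (rule power_le_one) auto
  thus ?thesis using mult_left_le_one_le[of "norm z" "\<bar>max 0 (min 1 t)\<bar> ^ n"]
    by (simp add: norm_mult norm_power)
qed

lemma integrable_unit_power_mult:
  fixes h :: "real \<Rightarrow> complex"
  assumes h: "integrable lborel h"
  shows "integrable lborel (\<lambda>t. of_real (max 0 (min 1 t)) ^ n * h t)"
proof (rule Bochner_Integration.integrable_bound[OF h])
  show "AE t in lborel. norm (of_real (max 0 (min 1 t)) ^ n * h t) \<le> norm (h t)"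
    by (intro AE_I2 norm_unit_power_mult_le)
qed (use borel_measurable_integrable[OF h] in measurable)

lemma norm_ext_beta_add_of_nat_le:
  assumes "set_integrable lborel {0<..<1} (ext_beta_integrand \<Theta> b d x y)"
  shows "norm (ext_beta \<Theta> b d (x + of_nat n) y) \<le>
           (\<integral>t. norm (indicator {0<..<1} t *\<^sub>R ext_beta_integrand \<Theta> b d x y t) \<partial>lborel)"
proof -
  let ?h = "\<lambda>t. indicator {0<..<1} t *\<^sub>R ext_beta_integrand \<Theta> b d x y t"
  have h: "integrable lborel ?h" using assms unfolding set_integrable_def .
  have "norm (ext_beta \<Theta> b d (x + of_nat n) y) \<le> (\<integral>t. norm (of_real (max 0 (min 1 t)) ^ n * ?h t) \<partial>lborel)"
    unfolding ext_beta_add_of_nat by (rule integral_norm_bound)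
  also have "\<dots> \<le> (\<integral>t. norm (?h t) \<partial>lborel)"
    by (rule integral_mono[OF integrable_norm[OF integrable_unit_power_mult[OF h]] integrable_norm[OF h]])
       (rule norm_unit_power_mult_le)
  finally show ?thesis .
qed

text \<open>The product is a moment sequence of a product measure pushed forward to \<open>[0, 1]\<close>.\<close>
lemma prod_ext_beta_vanishes_if_generating_function_entire:
  fixes k :: "'i \<Rightarrow> nat" and x y e :: "'i \<Rightarrow> complex"
  assumes I: "finite I"
    and int: "\<And>j. j \<in> I \<Longrightarrow> set_integrable lborel {0<..<1} (ext_beta_integrand \<Theta> b d (x j) (y j))"
    and entire: "\<And>w. summable (\<lambda>m. (\<Prod>j\<in>I. ext_beta \<Theta> b d (x j + of_nat (k j * m)) (y j) / e j) * w ^ m)"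
    and m: "2 \<le> m"
  shows "(\<Prod>j\<in>I. ext_beta \<Theta> b d (x j + of_nat (k j * m)) (y j) / e j) = 0"
proof -
  interpret product_sigma_finite "\<lambda>_::'i. lborel :: real measure" by standard
  define c where "c t = max 0 (min 1 t)" for t :: real
  define h where "h j t = indicator {0<..<1} t *\<^sub>R ext_beta_integrand \<Theta> b d (x j) (y j) t / e j" for j t
  \<comment> \<open>Since \<open>k j * m\<close> is linear in \<open>m\<close>, all the powers
    combine into \<open>u s ^ m\<close>; the clamping in \<open>c\<close> keeps \<open>u\<close>
    between 0 and 1 on the whole product space.\<close>
  define u where "u s = (\<Prod>j\<in>I. c (s j) ^ k j)" for s
  define N where "N = Pi\<^sub>M I (\<lambda>_. lborel :: real measure)"
  have h: "integrable lborel (h j)" if "j \<in> I" for j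
    using int[OF that] unfolding h_def set_integrable_def by (intro integrable_divide_zero) auto
  have c: "0 \<le> c t" "c t \<le> 1" for t by (auto simp: c_def)
  have moment: "(\<Prod>j\<in>I. ext_beta \<Theta> b d (x j + of_nat (k j * m)) (y j) / e j) =
      (\<integral>s. of_real (u s) ^ m * (\<Prod>j\<in>I. h j (s j)) \<partial>N)" for m
  proof -
    have "(\<Prod>j\<in>I. ext_beta \<Theta> b d (x j + of_nat (k j * m)) (y j) / e j) =
        (\<Prod>j\<in>I. \<integral>t. of_real (c t) ^ (k j * m) * h j t \<partial>lborel)"
      unfolding ext_beta_add_of_nat h_def c_def by simp
    also have "\<dots> = (\<integral>s. (\<Prod>j\<in>I. of_real (c (s j)) ^ (k j * m) * h j (s j)) \<partial>N)"
      unfolding N_def c_def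
      by (rule product_integral_prod[symmetric]) (use I h integrable_unit_power_mult in auto)
    also have "\<dots> = (\<integral>s. of_real (u s) ^ m * (\<Prod>j\<in>I. h j (s j)) \<partial>N)"
      by (simp add: u_def prod.distrib power_mult prod_power_distrib)
    finally show ?thesis .
  qed
  \<comment> \<open>Natural subtraction is exact here because \<open>2 \<le> m\<close>.\<close>
  have "(\<integral>s. of_real (u s) ^ (m - 2 + 2) * (\<Prod>j\<in>I. h j (s j)) \<partial>N) = 0"
  proof (rule moment_vanishes_if_generating_function_entire)
    show "integrable N (\<lambda>s. \<Prod>j\<in>I. h j (s j))"
      unfolding N_def by (rule product_integrable_prod) (use I h in auto)
    show "u \<in> borel_measurable N"
      unfolding u_def c_def N_def by measurable
    show "0 \<le> u s" "u s \<le> 1" for s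
      using c unfolding u_def by (auto intro!: prod_nonneg prod_le_1 power_le_one)
    show "summable (\<lambda>m. (\<integral>s. of_real (u s) ^ m * (\<Prod>j\<in>I. h j (s j)) \<partial>N) * w ^ m)" for w
      using entire[of w] unfolding moment .
  qed
  thus ?thesis unfolding moment le_add_diff_inverse2[OF m] .
qed

section \<open>Absolute convergence of the hypergeometric series\<close>

lemma summable_norm_if_le_power_fact:
  fixes f :: "nat \<Rightarrow> 'a :: real_normed_vector"
  assumes "\<And>m. norm (f m) \<le> C * K ^ m / fact m"
  shows "summable (\<lambda>m. norm (f m))"
proof (rule summable_comparison_test'[where N = 0])
  show "summable (\<lambda>m. C * (inverse (fact m) * K ^ m))"
    by (intro summable_mult summable_exp)
  show "norm (norm (f m)) \<le> C * (inverse (fact m) * K ^ m)" for m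
    using assms[of m] by (simp add: field_simps)
qed

text \<open>Each factor is a moment on the unit interval, hence at most the total variation
  \<open>B j\<close> of its measure, divided by \<open>norm (e j)\<close>.\<close>

lemma norm_prod_ext_beta_bounded:
  fixes k :: "'i \<Rightarrow> nat" and x y e :: "'i \<Rightarrow> complex"
  assumes "\<And>j. j \<in> I \<Longrightarrow> set_integrable lborel {0<..<1} (ext_beta_integrand \<Theta> b d (x j) (y j))"
  shows "\<exists>C\<ge>0. \<forall>m. norm (\<Prod>j\<in>I. ext_beta \<Theta> b d (x j + of_nat (k j * m)) (y j) / e j) \<le> C"
proof -
  define B where "B j = (\<integral>t. norm (indicator {0<..<1} t *\<^sub>R ext_beta_integrand \<Theta> b d (x j) (y j) t) \<partial>lborel)" for j
  have "norm (\<Prod>j\<in>I. ext_beta \<Theta> b d (x j + of_nat (k j * m)) (y j) / e j) \<le> (\<Prod>j\<in>I. B j / norm (e j))" for m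
    unfolding prod_norm[symmetric] norm_divide
    unfolding B_def
    by (intro prod_mono conjI divide_right_mono norm_ext_beta_add_of_nat_le assms) auto
  moreover have "0 \<le> (\<Prod>j\<in>I. B j / norm (e j))"
    by (intro prod_nonneg) (auto simp: B_def)
  ultimately show ?thesis by blast
qed

text \<open>Up to sign the coefficients are the binomial coefficients of exponent
  \<open>- a\<close>. The binomial series converges at a real \<open>r\<close> strictly between
  \<open>norm w\<close> and 1, hence absolutely at \<open>w\<close>.\<close>

lemma summable_norm_pochhammer_series:
  fixes a w :: complex
  assumes "norm w < 1"
  shows "summable (\<lambda>m. norm (pochhammer a m * w ^ m / fact m))"
proof -
  define r where "r = (1 + norm w) / 2"
  have r: "norm w < r" "r < 1" using assms by (auto simp: r_def)
  hence "norm (complex_of_real r) < 1" by simp (smt (verit) norm_ge_zero)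
  from gen_binomial_complex[OF this, of "- a"]
  have "summable (\<lambda>m. ((- a) gchoose m) * complex_of_real r ^ m)" by (rule sums_summable)
  from powser_insidea[OF this, of w] r
  have "summable (\<lambda>m. norm (((- a) gchoose m) * w ^ m))" by simp
  thus ?thesis by (simp add: gbinomial_pochhammer norm_mult norm_divide norm_power)
qed

lemma ext_hyp_term_power:
  assumes "p \<le> q + 1"
  shows "ext_hyp_term p q \<Theta> \<alpha> k \<beta> w b d m = ext_hyp_term p q \<Theta> \<alpha> k \<beta> 1 b d m * w ^ m"
  using assms unfolding ext_hyp_term_def by simp

text \<open>For \<open>p = q\<close> the product of Pochhammer symbols is empty, so cases (ii) and
  (iii) of the definition share one formula.\<close>

lemma ext_hyp_term_le:
  assumes "p \<le> q"
  shows "ext_hyp_term p q \<Theta> \<alpha> k \<beta> w b d m =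
    1 / (\<Prod>j = 1..q - p. pochhammer (\<beta> j) m) *
       (\<Prod>j = 1..p. ext_beta \<Theta> b d (\<alpha> j + of_nat (k j * m)) (\<beta> (q - p + j) - \<alpha> j) /
                    Beta (\<alpha> j) (\<beta> (q - p + j) - \<alpha> j)) * (w ^ m / fact m)"
  using assms unfolding ext_hyp_term_def by (cases "p = q") auto

text \<open>In every case the last upper parameter is paired with the last lower one, and
  \<open>q - p\<close> is unchanged when both are dropped. So exactly one beta quotient splits
  off.\<close>

lemma ext_hyp_term_reduce:
  assumes "1 \<le> p" "1 \<le> q" "p \<le> q + 1"
  shows "ext_hyp_term p q \<Theta> \<alpha> k \<beta> w b d m =
    ext_hyp_term (p - 1) (q - 1) \<Theta> \<alpha> k \<beta> w b d m *
      (ext_beta \<Theta> b d (\<alpha> p + of_nat (k p * m)) (\<beta> q - \<alpha> p) / Beta (\<alpha> p) (\<beta> q - \<alpha> p))"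
proof -
  obtain p' q' where pq: "p = Suc p'" "q = Suc q'"
    using assms by (metis One_nat_def Suc_le_D)
  show ?thesis
  proof (cases "p = q + 1")
    case True
    thus ?thesis unfolding ext_hyp_term_def pq by (simp add: mult_ac)
  next
    case False
    with assms show ?thesis
      unfolding pq by (subst (1 2) ext_hyp_term_le) (auto simp: mult_ac)
  qed
qed

lemma beta_args_pos_reduce:
  assumes "1 \<le> p" "1 \<le> q" "p \<le> q + 1" "beta_args_pos p q \<alpha> \<beta>"
  shows "beta_args_pos (p - 1) (q - 1) \<alpha> \<beta>"
  using assms unfolding beta_args_pos_def by (auto split: if_splits)

text \<open>This carries convergence from inside the segment to its end point. The bounded beta
  factors suffice unless \<open>p = q + 1\<close>, \<open>k 1 \<ge> 2\<close> and
  \<open>\<alpha> 1\<close> is not a nonpositive integer; there convergence at \<open>w0\<close>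
  makes the series a finite sum.\<close>

lemma summable_norm_ext_hyp_term:
  assumes pq: "p \<le> q + 1" and pos: "beta_args_pos p q \<alpha> \<beta>"
    and int: "\<And>x y. 0 < Re x \<Longrightarrow> 0 < Re y \<Longrightarrow>
           set_integrable lborel {0<..<1} (ext_beta_integrand \<Theta> b d x y)"
    and \<beta>: "\<forall>j\<in>{1..q}. \<beta> j \<notin> \<int>\<^sub>\<le>\<^sub>0"
    and w0: "w0 \<noteq> 0" and conv: "summable (\<lambda>m. norm (ext_hyp_term p q \<Theta> \<alpha> k \<beta> w0 b d m))"
    and w: "p = q + 1 \<Longrightarrow> norm w < 1"
  shows "summable (\<lambda>m. norm (ext_hyp_term p q \<Theta> \<alpha> k \<beta> w b d m))"
proof (cases "p = q + 1")
  case False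
  hence le: "p \<le> q" using pq by simp
  let ?H = "\<lambda>m. \<Prod>j = 1..p. ext_beta \<Theta> b d (\<alpha> j + of_nat (k j * m)) (\<beta> (q - p + j) - \<alpha> j) /
                    Beta (\<alpha> j) (\<beta> (q - p + j) - \<alpha> j)"
  have setint: "set_integrable lborel {0<..<1} (ext_beta_integrand \<Theta> b d (\<alpha> j) (\<beta> (q - p + j) - \<alpha> j))"
    if "j \<in> {1..p}" for j
    using pos that False by (intro int) (auto simp: beta_args_pos_def)
  have "\<exists>C\<ge>0. \<forall>m. norm (?H m) \<le> C"
    using setint by (rule norm_prod_ext_beta_bounded)
  then obtain C where C: "0 \<le> C" "\<And>m. norm (?H m) \<le> C"
    by blast
  have "\<exists>\<delta>>0. \<forall>m. \<delta> ^ m * fact m \<le> norm (pochhammer (\<beta> j) m)" if "j \<in> {1..q - p}" for j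
    using \<beta> that fact_le_norm_pochhammer[of "\<beta> j"] by (metis atLeastAtMost_iff diff_le_self le_trans)
  then obtain \<delta> where \<delta>: "\<And>j. j \<in> {1..q - p} \<Longrightarrow> \<delta> j > 0"
    "\<And>j m. j \<in> {1..q - p} \<Longrightarrow> \<delta> j ^ m * fact m \<le> norm (pochhammer (\<beta> j) m)"
    by metis
  \<comment> \<open>Estimating \<open>fact m\<close> below by 1 leaves a geometric lower bound for
    the denominators, and the remaining \<open>1 / fact m\<close> still gives an exponential
    majorant.\<close>
  define D where "D = (\<Prod>j = 1..q - p. \<delta> j)"
  have D: "0 < D" unfolding D_def using \<delta>(1) by (intro prod_pos) auto
  have lower: "D ^ m \<le> norm (\<Prod>j = 1..q - p. pochhammer (\<beta> j) m)" for m
  proof -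
    have "\<delta> j ^ m \<le> norm (pochhammer (\<beta> j) m)" if "j \<in> {1..q - p}" for j
    proof -
      have "\<delta> j ^ m * 1 \<le> \<delta> j ^ m * fact m"
        using \<delta>(1)[OF that] by (intro mult_left_mono fact_ge_1) auto
      thus ?thesis using \<delta>(2)[OF that, of m] by linarith
    qed
    thus ?thesis
      unfolding D_def prod_power_distrib prod_norm[symmetric]
      using \<delta>(1) by (intro prod_mono) (auto intro: less_imp_le)
  qed
  show ?thesis
  proof (rule summable_norm_if_le_power_fact)
    fix m
    have "norm (1 / (\<Prod>j = 1..q - p. pochhammer (\<beta> j) m)) \<le> 1 / D ^ m"
      using lower[of m] D by (simp add: norm_divide divide_simps)
    hence "norm (1 / (\<Prod>j = 1..q - p. pochhammer (\<beta> j) m)) * norm (?H m) * (norm w ^ m / fact m)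
        \<le> 1 / D ^ m * C * (norm w ^ m / fact m)"
      using C D by (intro mult_mono) auto
    thus "norm (ext_hyp_term p q \<Theta> \<alpha> k \<beta> w b d m) \<le> C * (norm w / D) ^ m / fact m"
      unfolding ext_hyp_term_le[OF le] by (simp add: norm_mult norm_divide norm_power power_divide mult_ac)
  qed
next
  case True
  let ?H = "\<lambda>m. \<Prod>j = 1..q. ext_beta \<Theta> b d (\<alpha> (j + 1) + of_nat (k (j + 1) * m)) (\<beta> j - \<alpha> (j + 1)) /
                    Beta (\<alpha> (j + 1)) (\<beta> j - \<alpha> (j + 1))"
  have term_eq: "ext_hyp_term p q \<Theta> \<alpha> k \<beta> v b d m = pochhammer (\<alpha> 1) (k 1 * m) * ?H m * (v ^ m / fact m)" for v m
    using True unfolding ext_hyp_term_def by simp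
  have setint: "set_integrable lborel {0<..<1} (ext_beta_integrand \<Theta> b d (\<alpha> (j + 1)) (\<beta> j - \<alpha> (j + 1)))"
    if "j \<in> {1..q}" for j
    using pos that True by (intro int) (auto simp: beta_args_pos_def)
  have "\<exists>C\<ge>0. \<forall>m. norm (?H m) \<le> C"
    using setint by (rule norm_prod_ext_beta_bounded)
  then obtain C where C: "0 \<le> C" "\<And>m. norm (?H m) \<le> C"
    by blast
  \<comment> \<open>The majorants are the exponential series for \<open>k 1 = 0\<close> and the
    binomial series for \<open>k 1 = 1\<close>. For larger \<open>k 1\<close> the Pochhammer factor
    either vanishes eventually or outgrows \<open>fact m\<close>.\<close>
  consider "k 1 = 0" | "k 1 = 1" | "2 \<le> k 1" "\<alpha> 1 \<in> \<int>\<^sub>\<le>\<^sub>0" | "2 \<le> k 1" "\<alpha> 1 \<notin> \<int>\<^sub>\<le>\<^sub>0"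
    by linarith
  thus ?thesis
  proof cases
    case 1
    show ?thesis
    proof (rule summable_norm_if_le_power_fact)
      fix m
      show "norm (ext_hyp_term p q \<Theta> \<alpha> k \<beta> w b d m) \<le> C * norm w ^ m / fact m"
        using mult_right_mono[OF C(2)[of m], of "norm w ^ m / fact m"]
        unfolding term_eq 1 by (simp add: norm_mult norm_divide norm_power)
    qed
  next
    case 2
    show ?thesis
    proof (rule summable_comparison_test'[where N = 0])
      show "summable (\<lambda>m. C * norm (pochhammer (\<alpha> 1) m * w ^ m / fact m))"
        using w[OF True] by (intro summable_mult summable_norm_pochhammer_series)
      fix m
      show "norm (norm (ext_hyp_term p q \<Theta> \<alpha> k \<beta> w b d m)) \<le> C * norm (pochhammer (\<alpha> 1) m * w ^ m / fact m)"
        using mult_right_mono[OF C(2)[of m], of "norm (pochhammer (\<alpha> 1) m * w ^ m / fact m)"]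
        unfolding term_eq 2 by (simp add: norm_mult norm_divide norm_power mult_ac)
    qed
  next
    case 3
    then obtain n where n: "\<alpha> 1 = - of_nat n" by (elim nonpos_Ints_cases')
    show ?thesis
    proof (rule summable_finite[of "{..n}"])
      fix m assume "m \<notin> {..n}"
      hence "n < 1 * m" by simp
      also have "1 * m \<le> k 1 * m" using 3 by (intro mult_le_mono1) simp
      finally have "n < k 1 * m" .
      hence "pochhammer (\<alpha> 1) (k 1 * m) = 0"
        unfolding n pochhammer_eq_0_iff by blast
      thus "norm (ext_hyp_term p q \<Theta> \<alpha> k \<beta> w b d m) = 0" unfolding term_eq by simp
    qed auto
  next
    case 4
    obtain \<delta> where \<delta>: "\<delta> > 0" "\<And>n. \<delta> ^ n * fact n \<le> norm (pochhammer (\<alpha> 1) n)"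
      using fact_le_norm_pochhammer[OF 4(2)] by blast
    obtain B where B: "\<And>m. norm (ext_hyp_term p q \<Theta> \<alpha> k \<beta> w0 b d m) \<le> B"
      using summable_imp_Bseq[OF conv] unfolding Bseq_def by auto
    \<comment> \<open>The Pochhammer factor is at least a geometric term times
      \<open>fact m * fact m\<close>. One factorial cancels the \<open>1 / fact m\<close> of the
      series; the other remains and makes \<open>?H m\<close> decay fast enough for an entire
      generating function.\<close>
    have H_bound: "norm (?H m) \<le> B * (1 / (\<delta> ^ k 1 * norm w0)) ^ m / fact m" for m
    proof -
      have "fact m * fact m \<le> (fact (k 1 * m) :: real)"
        using square_fact_le_2_fact[of m] fact_mono[of "2 * m" "k 1 * m", where 'a = real] 4(1) by simp
      hence "\<delta> ^ (k 1 * m) * (fact m * fact m) \<le> norm (pochhammer (\<alpha> 1) (k 1 * m))"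
        using \<delta>(1) by (intro order.trans[OF mult_left_mono \<delta>(2)]) auto
      hence "\<delta> ^ (k 1 * m) * (fact m * fact m) * (norm (?H m) * (norm w0 ^ m / fact m))
          \<le> norm (pochhammer (\<alpha> 1) (k 1 * m)) * (norm (?H m) * (norm w0 ^ m / fact m))"
        by (rule mult_right_mono) simp
      also have "\<dots> \<le> B"
        using B[of m] unfolding term_eq norm_mult norm_divide norm_power by (simp add: mult_ac)
      finally have "norm (?H m) * (fact m * (\<delta> ^ k 1 * norm w0) ^ m) \<le> B"
        by (simp add: power_mult_distrib power_mult[symmetric] mult_ac)
      moreover have "fact m * (\<delta> ^ k 1 * norm w0) ^ m > 0" using \<delta> w0 by simp
      ultimately have "norm (?H m) \<le> B / (fact m * (\<delta> ^ k 1 * norm w0) ^ m)"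
        by (subst pos_le_divide_eq)
      thus ?thesis by (simp add: power_divide mult_ac)
    qed
    have vanish: "?H m = 0" if "2 \<le> m" for m
    proof (rule prod_ext_beta_vanishes_if_generating_function_entire[OF _ setint _ that])
      show "summable (\<lambda>m. ?H m * v ^ m)" for v
      proof (rule summable_norm_cancel, rule summable_norm_if_le_power_fact)
        fix m
        show "norm (?H m * v ^ m) \<le> B * (1 / (\<delta> ^ k 1 * norm w0) * norm v) ^ m / fact m"
          using mult_right_mono[OF H_bound[of m], of "norm v ^ m"]
          unfolding norm_mult norm_power power_mult_distrib by (simp add: mult_ac)
      qed
    qed auto
    show ?thesis
      by (rule summable_finite[of "{..<2}"]) (use vanish in \<open>auto simp: term_eq\<close>)
  qed
qed

section \<open>Term-by-term integration and powers along the segment\<close>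

text \<open>Clamped powers are at most 1, so \<open>norm (a m) * norm (h t)\<close> dominates the
  terms and is summable after integration, which justifies exchanging sum and integral.\<close>

lemma sums_integral_unit_powers:
  fixes h :: "real \<Rightarrow> complex" and a :: "nat \<Rightarrow> complex" and k :: nat
  assumes h: "integrable lborel h" and a: "summable (\<lambda>m. norm (a m))"
  defines "F \<equiv> \<lambda>t. \<Sum>m. a m * (of_real (max 0 (min 1 t)) ^ (k * m) * h t)"
  shows "integrable lborel F"
    and "(\<lambda>m. a m * (\<integral>t. of_real (max 0 (min 1 t)) ^ (k * m) * h t \<partial>lborel)) sums (\<integral>t. F t \<partial>lborel)"
proof -
  have le: "norm (a m * (of_real (max 0 (min 1 t)) ^ (k * m) * h t)) \<le> norm (a m) * norm (h t)" for m t
    unfolding norm_mult[of "a m"] by (intro mult_left_mono norm_unit_power_mult_le) auto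
  have I: "integrable lborel (\<lambda>t. a m * (of_real (max 0 (min 1 t)) ^ (k * m) * h t))" for m
    by (intro integrable_mult_right integrable_unit_power_mult h)
  have AE: "AE t in lborel. summable (\<lambda>m. norm (a m * (of_real (max 0 (min 1 t)) ^ (k * m) * h t)))"
  proof (rule AE_I2)
    fix t
    show "summable (\<lambda>m. norm (a m * (of_real (max 0 (min 1 t)) ^ (k * m) * h t)))"
      by (rule summable_comparison_test'[OF summable_mult2[OF a, of "norm (h t)"], where N = 0])
         (use le in auto)
  qed
  have S: "summable (\<lambda>m. \<integral>t. norm (a m * (of_real (max 0 (min 1 t)) ^ (k * m) * h t)) \<partial>lborel)"
  proof (rule summable_comparison_test'[OF summable_mult2[OF a, of "\<integral>t. norm (h t) \<partial>lborel"], where N = 0])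
    fix m
    have "(\<integral>t. norm (a m * (of_real (max 0 (min 1 t)) ^ (k * m) * h t)) \<partial>lborel)
        \<le> (\<integral>t. norm (a m) * norm (h t) \<partial>lborel)"
      by (rule integral_mono[OF integrable_norm[OF I] integrable_mult_right[OF integrable_norm[OF h]] le])
    thus "norm (\<integral>t. norm (a m * (of_real (max 0 (min 1 t)) ^ (k * m) * h t)) \<partial>lborel)
        \<le> norm (a m) * (\<integral>t. norm (h t) \<partial>lborel)"
      by simp
  qed
  show "integrable lborel F"
    unfolding F_def by (rule integrable_suminf[OF I AE S])
  show "(\<lambda>m. a m * (\<integral>t. of_real (max 0 (min 1 t)) ^ (k * m) * h t \<partial>lborel)) sums (\<integral>t. F t \<partial>lborel)"
    using sums_integral[OF I AE S] unfolding F_def by simp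
qed

text \<open>Dividing by \<open>exp L\<close> leaves the positive real \<open>v\<close>, whose
  principal logarithm is real, so the chosen branch splits off as a constant. The same formula
  serves \<open>t = z v\<close> and \<open>z - t = z (1 - v)\<close>.\<close>

lemma ray_powr_mult:
  assumes "0 < v"
  shows "ray_powr L (exp L * of_real v) a = exp (a * L) * of_real v powr a"
  using assms unfolding ray_powr_def powr_def by (simp add: ring_distribs exp_add)

section \<open>The integral representation\<close>

theorem theorem2p9:
  fixes \<kappa> :: "nat \<Rightarrow> complex" and R M0 :: real and \<omega> :: complex and \<Theta> :: "complex \<Rightarrow> complex"
    and p q :: nat and \<alpha> \<beta> :: "nat \<Rightarrow> complex" and k :: "nat \<Rightarrow> nat"
    and b d c z L :: complex
  assumes "theta_kernel \<kappa> R M0 \<omega> \<Theta>"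
    and "0 \<le> Re b" and "0 \<le> Re d"
    and "\<And>x y. 0 < Re x \<Longrightarrow> 0 < Re y \<Longrightarrow>
           set_integrable lborel {0<..<1} (ext_beta_integrand \<Theta> b d x y)"
    and "1 \<le> p" and "1 \<le> q" and "p \<le> q + 1"
    and "Re (\<beta> q) > Re (\<alpha> p)" and "Re (\<alpha> p) > 0"
    and "\<forall>j\<in>{1..q}. \<beta> j \<notin> \<int>\<^sub>\<le>\<^sub>0"
    and "beta_args_pos p q \<alpha> \<beta>"
    and "z \<noteq> 0" and "exp L = z"
    and "ext_hyp_converges p q \<Theta> \<alpha> k \<beta> (c * z ^ k p) b d"
    and "\<forall>t\<in>open_segment 0 z. ext_hyp_converges (p - 1) (q - 1) \<Theta> \<alpha> k \<beta> (c * t ^ k p) b d"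
  shows "let f = (\<lambda>t. ray_powr L t (\<alpha> p - 1) * ray_powr L (z - t) (\<beta> q - \<alpha> p - 1) *
                      ext_hyp (p - 1) (q - 1) \<Theta> \<alpha> k \<beta> (c * t ^ k p) b d *
                      \<Theta> (- (b * z / t) - d * z / (z - t)))
         in f contour_integrable_on linepath 0 z \<and>
            ext_hyp p q \<Theta> \<alpha> k \<beta> (c * z ^ k p) b d =
              Gamma (\<beta> q) * ray_powr L z (1 - \<beta> q) / (Gamma (\<alpha> p) * Gamma (\<beta> q - \<alpha> p)) *
              contour_integral (linepath 0 z) f"
proof -
  note int = assms(4) and p1 = assms(5) and q1 = assms(6) and pq = assms(7)
    and z = assms(12) and L = assms(13)
  define f where "f = (\<lambda>t. ray_powr L t (\<alpha> p - 1) * ray_powr L (z - t) (\<beta> q - \<alpha> p - 1) *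
                      ext_hyp (p - 1) (q - 1) \<Theta> \<alpha> k \<beta> (c * t ^ k p) b d *
                      \<Theta> (- (b * z / t) - d * z / (z - t)))"
  \<comment> \<open>Terms at the end point of the segment: at \<open>z v\<close> they only acquire
    the factor \<open>v ^ (k p * m)\<close>, so they are dominated uniformly in
    \<open>v\<close>.\<close>
  define a where "a m = ext_hyp_term (p - 1) (q - 1) \<Theta> \<alpha> k \<beta> (c * z ^ k p) b d m" for m
  define \<phi> where "\<phi> = ext_beta_integrand \<Theta> b d (\<alpha> p) (\<beta> q - \<alpha> p)"
  define h where "h t = indicator {0<..<1} t *\<^sub>R \<phi> t" for t
  define F where "F t = (\<Sum>m. a m * (of_real (max 0 (min 1 t)) ^ (k p * m) * h t))" for t
  have pq': "p - 1 \<le> q - 1 + 1" using pq by simp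
  have a: "summable (\<lambda>m. norm (a m))"
  \<comment> \<open>The transfer of convergence starts from a nonzero argument; for
    \<open>c = 0\<close> only the term with \<open>m = 0\<close> can be nonzero.\<close>
  proof (cases "c = 0")
    case True
    show ?thesis
      by (rule summable_finite[of "{0}"])
         (use pq' in \<open>auto simp: a_def True ext_hyp_term_def\<close>)
  next
    case False
    \<comment> \<open>Any point of the open segment would serve as starting point. The end point
      \<open>z\<close> is not in it, and there the bound \<open>norm (c * z ^ k p) < 1\<close> comes
      from convergence of the left-hand series.\<close>
    have "z / 2 \<in> open_segment 0 z"
      using z by (auto simp: in_segment scaleR_conv_of_real intro!: exI[of _ "1 / 2 :: real"])
    hence "summable (\<lambda>m. norm (ext_hyp_term (p - 1) (q - 1) \<Theta> \<alpha> k \<beta> (c * (z / 2) ^ k p) b d m))"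
      using assms(15) unfolding ext_hyp_converges_def by blast
    moreover have "c * (z / 2) ^ k p \<noteq> 0" using False z by simp
    moreover have "norm (c * z ^ k p) < 1" if "p - 1 = q - 1 + 1"
    proof -
      have "p = q + 1" using that p1 q1 by simp
      thus ?thesis using assms(14) unfolding ext_hyp_converges_def by blast
    qed
    moreover have "\<forall>j\<in>{1..q - 1}. \<beta> j \<notin> \<int>\<^sub>\<le>\<^sub>0" using assms(10) by auto
    ultimately show ?thesis
      unfolding a_def
      using summable_norm_ext_hyp_term[OF pq' beta_args_pos_reduce[OF p1 q1 pq assms(11)] int] by blast
  qed
  have h: "integrable lborel h"
    using int[of "\<alpha> p" "\<beta> q - \<alpha> p"] assms(8,9)
    unfolding h_def \<phi>_def set_integrable_def by simp
  note sums = sums_integral_unit_powers[OF h a, of "k p", folded F_def]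
  have "ext_hyp_term p q \<Theta> \<alpha> k \<beta> (c * z ^ k p) b d =
      (\<lambda>m. a m * (\<integral>t. of_real (max 0 (min 1 t)) ^ (k p * m) * h t \<partial>lborel) / Beta (\<alpha> p) (\<beta> q - \<alpha> p))"
    unfolding fun_eq_iff ext_hyp_term_reduce[OF p1 q1 pq] ext_beta_add_of_nat a_def h_def \<phi>_def by simp
  with sums_divide[OF sums(2), of "Beta (\<alpha> p) (\<beta> q - \<alpha> p)"]
  have lhs: "ext_hyp p q \<Theta> \<alpha> k \<beta> (c * z ^ k p) b d = (\<integral>t. F t \<partial>lborel) / Beta (\<alpha> p) (\<beta> q - \<alpha> p)"
    unfolding ext_hyp_def by (simp only: sums_iff)
  \<comment> \<open>Summing the series identifies \<open>F\<close> as the inner function at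
    \<open>t = z v\<close> times the extended beta integrand.\<close>
  have F_eq: "F v = indicator {0<..<1} v *\<^sub>R (ext_hyp (p - 1) (q - 1) \<Theta> \<alpha> k \<beta> (c * (z * of_real v) ^ k p) b d * \<phi> v)" for v
  proof (cases "v \<in> {0<..<1}")
    case True
    have t: "a m * of_real v ^ (k p * m) = ext_hyp_term (p - 1) (q - 1) \<Theta> \<alpha> k \<beta> (c * (z * of_real v) ^ k p) b d m" for m
      unfolding a_def
      by (subst (1 2) ext_hyp_term_power[OF pq']) (simp add: power_mult_distrib power_mult)
    have "norm (a m * of_real v ^ (k p * m)) \<le> norm (a m)" for m
      using True by (auto simp: norm_mult norm_power intro!: mult_right_le_one_le power_le_one)
    hence "summable (\<lambda>m. a m * of_real v ^ (k p * m))"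
      by (intro summable_norm_cancel[OF summable_comparison_test'[OF a, where N = 0]]) simp
    from suminf_mult2[OF this, of "\<phi> v"] show ?thesis
      using True unfolding F_def h_def ext_hyp_def t[symmetric] by (simp add: mult.assoc)
  qed (simp add: F_def h_def)
  \<comment> \<open>The contour integral is a gauge integral over the closed unit interval.
    \<open>F\<close> vanishes off the open one, and the two end points are negligible.\<close>
  have "(F has_integral (\<integral>t. F t \<partial>lborel)) UNIV"
    by (rule has_integral_integral_lborel[OF sums(1)])
  moreover have "F = (\<lambda>t. if t \<in> {0<..<1} then F t else 0)"
    using F_eq by (auto simp: fun_eq_iff)
  ultimately have "(F has_integral (\<integral>t. F t \<partial>lborel)) {0<..<1}"
    using has_integral_restrict_UNIV by metis
  hence "((\<lambda>v. exp ((\<beta> q - 1) * L) * F v) has_integral exp ((\<beta> q - 1) * L) * (\<integral>t. F t \<partial>lborel)) {0<..<1}"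
    by (rule has_integral_mult_right)
  moreover have "exp ((\<beta> q - 1) * L) * F v = f (linepath 0 z v) * (z - 0)" if v: "v \<in> {0<..<1}" for v
  proof -
    have lp: "linepath 0 z v = exp L * of_real v" by (simp add: linepath_def L scaleR_conv_of_real)
    have zl: "z - exp L * of_real v = exp L * of_real (1 - v)" by (simp add: L algebra_simps)
    have arg: "- (b * z / (exp L * of_real v)) - d * z / (exp L * of_real (1 - v)) =
        - b / of_real v - d / of_real (1 - v)"
      unfolding L using z by simp
    \<comment> \<open>The two powers contribute \<open>\<alpha> p - 1\<close> and
      \<open>\<beta> q - \<alpha> p - 1\<close> to the exponent of \<open>z\<close>; the missing 1
      comes from \<open>dt = z dv\<close>.\<close>
    have split: "exp ((\<alpha> p - 1) * L) * exp ((\<beta> q - \<alpha> p - 1) * L) * z = exp ((\<beta> q - 1) * L)"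
      unfolding L[symmetric] exp_add[symmetric] by (simp add: algebra_simps)
    have "0 < v" "0 < 1 - v" using v by auto
    note ray = this[THEN ray_powr_mult]
    show ?thesis
      using v unfolding F_eq f_def lp zl arg ray \<phi>_def ext_beta_integrand_def split[symmetric]
      by (simp add: L mult_ac del: of_real_diff)
  qed
  ultimately have "((\<lambda>v. f (linepath 0 z v) * (z - 0)) has_integral exp ((\<beta> q - 1) * L) * (\<integral>t. F t \<partial>lborel)) {0<..<1}"
    by (rule has_integral_eq[rotated])
  hence ci: "(f has_contour_integral exp ((\<beta> q - 1) * L) * (\<integral>t. F t \<partial>lborel)) (linepath 0 z)"
    unfolding has_contour_integral_linepath by (simp add: has_integral_Icc_iff_Ioo)
  \<comment> \<open>At \<open>z\<close> itself \<open>v = 1\<close> and the real logarithm is 0, so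
    the prefactor cancels the power of \<open>z\<close> from the substitution. The Gamma quotient
    that remains is the reciprocal of the beta function.\<close>
  have "ray_powr L z (1 - \<beta> q) * exp ((\<beta> q - 1) * L) = 1"
    using z unfolding ray_powr_def L by (simp add: exp_add[symmetric] algebra_simps)
  hence "Gamma (\<beta> q) * ray_powr L z (1 - \<beta> q) / (Gamma (\<alpha> p) * Gamma (\<beta> q - \<alpha> p)) *
      (exp ((\<beta> q - 1) * L) * (\<integral>t. F t \<partial>lborel)) = (\<integral>t. F t \<partial>lborel) / Beta (\<alpha> p) (\<beta> q - \<alpha> p)"
    by (simp add: Beta_def field_simps)
  with lhs ci show ?thesis
    unfolding Let_def f_def[symmetric]
    by (auto simp: has_contour_integral_integrable contour_integral_unique)
qed

end
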